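(* Let $n\ge1$ be an integer, $Q=2n+2$, $T>0$, $p,q>1$. Let $M_1,M_2:\mathbb R_+^5\to\mathbb R$ be bounded functions such that $0<M_i(\cdot,\cdot,\cdot,\cdot,\cdot)\le C_i$ for some constants $C_i$, $i=1,2$. Let $(u_0,v_0),(u_1,v_1)\in L^1(\mathbb H^n)\times L^1(\mathbb H^n)$ with $$\int_{\mathbb H^n}u_1\,dx\ge0\quad\text{and}\quad\int_{\mathbb H^n}v_1\,dx\ge0.$$ If $$1<pq\le1+\frac2{Q-1}\max\{p+1,\,q+1\},$$ then there exists no nontrivial weak solution $(u,v)$ to the system $$\begin{cases}u_{tt}-M_1\left(t,\int|\nabla_{\mathbb H}u|^2dx,\int|\nabla_{\mathbb H}v|^2dx,\int|\Delta_{\mathbb H}u|^2dx,\int|\Delta_{\mathbb H}v|^2dx\right)(\Delta_{\mathbb H}u+\Delta_{\mathbb H}u_{tt})=|v|^q,\\ v_{tt}-M_2\left(t,\int|\nabla_{\mathbb H}u|^2dx,\int|\nabla_{\mathbb H}v|^2dx,\int|\Delta_{\mathbb H}u|^2dx,\int|\Delta_{\mathbb H}v|^2dx\right)(\Delta_{\mathbb H}v+\Delta_{\mathbb H}v_{tt})=|u|^p,\\ u(x,0)=u_0(x),\ u_t(x,0)=u_1(x),\quad x\in\mathbb H^n,\\ v(x,0)=v_0(x),\ v_t(x,0)=v_1(x),\quad x\in\mathbb H^n,\end{cases}$$ with the equations posed for $(x,t)\in\Omega=\mathbb H^n\times(0,T)$, where the inner integrals are over $\mathbb H^n$.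
   Context: $\mathbb R_+=[0,\infty)$. The Heisenberg group $\mathbb H^n$ is $\mathbb R^{2n+1}$ with points $x=(\xi,\tilde\xi,\tau)$, $\xi,\tilde\xi\in\mathbb R^n$, $\tau\in\mathbb R$, equipped with the vector fields $X_i=\partial_{\xi_i}+2\tilde\xi_i\partial_\tau$, $Y_i=\partial_{\tilde\xi_i}-2\xi_i\partial_\tau$ ($i=1,\dots,n$) and with Lebesgue measure $dx$; its homogeneous dimension is $Q=2n+2$ (dilations $\delta_\lambda(x)=(\lambda\xi,\lambda\tilde\xi,\lambda^2\tau)$). The horizontal gradient is $\nabla_{\mathbb H}=(X_1,\dots,X_n,Y_1,\dots,Y_n)$ and the Kohn-Laplacian is $\Delta_{\mathbb H}=\sum_{i=1}^n(X_i^2+Y_i^2)$; both act in the variable $x$ only. $S^2_2(\mathbb H^n)=\{u: u\in L^2(\mathbb H^n),\ |\nabla_{\mathbb H}u|\in L^2(\mathbb H^n),\ |\Delta_{\mathbb H}u|\in L^2(\mathbb H^n)\}$. For a pair $(u,v)$ write, for $i=1,2$, $M_i[t]=M_i\left(t,\int_{\mathbb H^n}|\nabla_{\mathbb H}u|^2dx,\int_{\mathbb H^n}|\nabla_{\mathbb H}v|^2dx,\int_{\mathbb H^n}|\Delta_{\mathbb H}u|^2dx,\int_{\mathbb H^n}|\Delta_{\mathbb H}v|^2dx\right)$, where the integrals are taken at time $t$. Definition. A pair $(u,v)$ is a weak solution of the system on $\Omega=\mathbb H^n\times(0,T)$ with initial data $(u(x,0),v(x,0))=(u_0,v_0)\in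 L^1_{loc}(\mathbb H^n)\times L^1_{loc}(\mathbb H^n)$ if $u\in C^2(0,T;S^2_2(\mathbb H^n))\cap L^p(\Omega)$, $v\in C^2(0,T;S^2_2(\mathbb H^n))\cap L^q(\Omega)$ and $$\int_\Omega|v|^q\varphi\,dxdt+\int_{\mathbb H^n}u_1(x)\bigl(\varphi(x,0)-\Delta_{\mathbb H}\varphi(x,0)\bigr)dx-\int_{\mathbb H^n}u_0(x)\bigl(\varphi_t(x,0)-\Delta_{\mathbb H}\varphi_t(x,0)\bigr)dx=\int_\Omega u\varphi_{tt}\,dxdt-\int_\Omega M_1[t]\,u\,(\Delta_{\mathbb H}\varphi+\Delta_{\mathbb H}\varphi_{tt})\,dxdt$$ and $$\int_\Omega|u|^p\psi\,dxdt+\int_{\mathbb H^n}v_1(x)\bigl(\psi(x,0)-\Delta_{\mathbb H}\psi(x,0)\bigr)dx-\int_{\mathbb H^n}v_0(x)\bigl(\psi_t(x,0)-\Delta_{\mathbb H}\psi_t(x,0)\bigr)dx=\int_\Omega v\psi_{tt}\,dxdt-\int_\Omega M_2[t]\,v\,(\Delta_{\mathbb H}\psi+\Delta_{\mathbb H}\psi_{tt})\,dxdt$$ for any test functions $0\le\varphi,\psi\in C^{2,2}_{x,t}(\Omega)$ (twice continuously differentiable in $x$ and in $t$). *)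

theory Defs
  imports "HOL-Analysis.Analysis"
begin

text \<open>
  The Heisenberg group is \<open>\<real>\<^sup>n \<times> \<real>\<^sup>n \<times> \<real>\<close> with \<open>n = CARD('n)\<close>; a point is a triple
  \<open>(\<xi>, \<eta>, \<tau>)\<close>. Functions of space and time are curried with time first, so that
  \<open>u t\<close> is the spatial function at time \<open>t\<close>. Measurability and integrals refer to
  \<open>lebesgue\<close>, i.e. the completed Lebesgue measure, on space and on space-time.
\<close>

type_synonym 'n heis = "(real^'n) \<times> (real^'n) \<times> real"

section \<open>Classical derivatives\<close>

definition pdir :: "'n::finite heis \<Rightarrow> ('n heis \<Rightarrow> real) \<Rightarrow> 'n heis \<Rightarrow> real" where
  "pdir b f x = deriv (\<lambda>s. f (x + s *\<^sub>R b)) 0"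

definition e_xi :: "'n::finite \<Rightarrow> 'n heis" where "e_xi i = (axis i 1, 0, 0)"
definition e_eta :: "'n::finite \<Rightarrow> 'n heis" where "e_eta i = (0, axis i 1, 0)"
definition e_tau :: "'n::finite heis" where "e_tau = (0, 0, 1)"

definition X_field :: "'n::finite \<Rightarrow> ('n heis \<Rightarrow> real) \<Rightarrow> 'n heis \<Rightarrow> real" where
  "X_field i f = (\<lambda>(\<xi>, \<eta>, \<tau>). pdir (e_xi i) f (\<xi>, \<eta>, \<tau>) + 2 * (\<eta> $ i) * pdir e_tau f (\<xi>, \<eta>, \<tau>))"

definition Y_field :: "'n::finite \<Rightarrow> ('n heis \<Rightarrow> real) \<Rightarrow> 'n heis \<Rightarrow> real" where
  "Y_field i f = (\<lambda>(\<xi>, \<eta>, \<tau>). pdir (e_eta i) f (\<xi>, \<eta>, \<tau>) - 2 * (\<xi> $ i) * pdir e_tau f (\<xi>, \<eta>, \<tau>))"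

definition kohn_laplacian :: "('n::finite heis \<Rightarrow> real) \<Rightarrow> 'n heis \<Rightarrow> real" where
  "kohn_laplacian f x = (\<Sum>i\<in>UNIV. X_field i (X_field i f) x + Y_field i (Y_field i f) x)"

text \<open>
  \<open>foldr pdir bs f\<close> is the iterated partial derivative of \<open>f\<close> along the list \<open>bs\<close> of
  coordinate directions.
\<close>

definition test_fun_space :: "('n::finite heis \<Rightarrow> real) \<Rightarrow> bool" where
  "test_fun_space f \<longleftrightarrow>
     (\<forall>bs\<in>lists Basis. continuous_on UNIV (foldr pdir bs f) \<and>
        (\<forall>b\<in>Basis. \<forall>x. (\<lambda>s. foldr pdir bs f (x + s *\<^sub>R b)) differentiable (at 0))) \<and>
     (\<exists>K. compact K \<and> (\<forall>x. x \<notin> K \<longrightarrow> f x = 0))"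

section \<open>Weak derivatives and the Sobolev space\<close>

definition L1_loc :: "('n::finite heis \<Rightarrow> real) \<Rightarrow> bool" where
  "L1_loc f \<longleftrightarrow> (\<forall>K. compact K \<longrightarrow> set_integrable lebesgue K f)"

definition L2 :: "('n::finite heis \<Rightarrow> real) \<Rightarrow> bool" where
  "L2 f \<longleftrightarrow> f \<in> borel_measurable lebesgue \<and> integrable lebesgue (\<lambda>x. (f x)\<^sup>2)"

text \<open>
  The vector fields are divergence free, so their formal adjoints are their negatives, and
  the Kohn-Laplacian is formally self-adjoint.
\<close>

definition has_weak_X :: "'n::finite \<Rightarrow> ('n heis \<Rightarrow> real) \<Rightarrow> ('n heis \<Rightarrow> real) \<Rightarrow> bool" where
  "has_weak_X i f g \<longleftrightarrow> L1_loc f \<and> L1_loc g \<and>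
     (\<forall>\<phi>. test_fun_space \<phi> \<longrightarrow>
        (LINT x|lebesgue. f x * X_field i \<phi> x) = - (LINT x|lebesgue. g x * \<phi> x))"

definition has_weak_Y :: "'n::finite \<Rightarrow> ('n heis \<Rightarrow> real) \<Rightarrow> ('n heis \<Rightarrow> real) \<Rightarrow> bool" where
  "has_weak_Y i f g \<longleftrightarrow> L1_loc f \<and> L1_loc g \<and>
     (\<forall>\<phi>. test_fun_space \<phi> \<longrightarrow>
        (LINT x|lebesgue. f x * Y_field i \<phi> x) = - (LINT x|lebesgue. g x * \<phi> x))"

definition has_weak_kohn :: "('n::finite heis \<Rightarrow> real) \<Rightarrow> ('n heis \<Rightarrow> real) \<Rightarrow> bool" where
  "has_weak_kohn f h \<longleftrightarrow> L1_loc f \<and> L1_loc h \<and>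
     (\<forall>\<phi>. test_fun_space \<phi> \<longrightarrow>
        (LINT x|lebesgue. f x * kohn_laplacian \<phi> x) = (LINT x|lebesgue. h x * \<phi> x))"

text \<open>Weak derivatives are unique only almost everywhere; we choose representatives.\<close>

definition weak_X :: "'n::finite \<Rightarrow> ('n heis \<Rightarrow> real) \<Rightarrow> 'n heis \<Rightarrow> real" where
  "weak_X i f = (SOME g. has_weak_X i f g)"

definition weak_Y :: "'n::finite \<Rightarrow> ('n heis \<Rightarrow> real) \<Rightarrow> 'n heis \<Rightarrow> real" where
  "weak_Y i f = (SOME g. has_weak_Y i f g)"

definition weak_kohn :: "('n::finite heis \<Rightarrow> real) \<Rightarrow> 'n heis \<Rightarrow> real" where
  "weak_kohn f = (SOME h. has_weak_kohn f h)"

definition hgrad_norm :: "('n::finite heis \<Rightarrow> real) \<Rightarrow> 'n heis \<Rightarrow> real" where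
  "hgrad_norm f x = sqrt (\<Sum>i\<in>UNIV. (weak_X i f x)\<^sup>2 + (weak_Y i f x)\<^sup>2)"

definition S22 :: "('n::finite heis \<Rightarrow> real) set" where
  "S22 = {f. L2 f \<and>
     (\<forall>i. (\<exists>g. has_weak_X i f g) \<and> (\<exists>g. has_weak_Y i f g)) \<and> L2 (hgrad_norm f) \<and>
     (\<exists>h. has_weak_kohn f h) \<and> L2 (weak_kohn f)}"

definition grad_energy :: "('n::finite heis \<Rightarrow> real) \<Rightarrow> real" where
  "grad_energy f = (LINT x|lebesgue. (hgrad_norm f x)\<^sup>2)"

definition kohn_energy :: "('n::finite heis \<Rightarrow> real) \<Rightarrow> real" where
  "kohn_energy f = (LINT x|lebesgue. (weak_kohn f x)\<^sup>2)"

definition S22_norm :: "('n::finite heis \<Rightarrow> real) \<Rightarrow> real" where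
  "S22_norm f = sqrt ((LINT x|lebesgue. (f x)\<^sup>2) + grad_energy f + kohn_energy f)"

text \<open>
  Twice continuously differentiable curves in \<open>S22\<close>, on the open interval. The elements of
  \<open>S22\<close> are functions rather than equivalence classes, so \<open>S22_norm\<close> is only a
  seminorm and limits are expressed through it.
\<close>

definition S22_deriv_on ::
    "real set \<Rightarrow> (real \<Rightarrow> 'n::finite heis \<Rightarrow> real) \<Rightarrow> (real \<Rightarrow> 'n heis \<Rightarrow> real) \<Rightarrow> bool" where
  "S22_deriv_on I w w' \<longleftrightarrow> (\<forall>t\<in>I.
     ((\<lambda>s. S22_norm (\<lambda>x. (w s x - w t x) / (s - t) - w' t x)) \<longlongrightarrow> 0) (at t))"

definition S22_continuous_on :: "real set \<Rightarrow> (real \<Rightarrow> 'n::finite heis \<Rightarrow> real) \<Rightarrow> bool" where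
  "S22_continuous_on I w \<longleftrightarrow> (\<forall>t\<in>I.
     ((\<lambda>s. S22_norm (\<lambda>x. w s x - w t x)) \<longlongrightarrow> 0) (at t))"

definition C2_S22 :: "real \<Rightarrow> (real \<Rightarrow> 'n::finite heis \<Rightarrow> real) \<Rightarrow> bool" where
  "C2_S22 T w \<longleftrightarrow> (\<exists>w' w''.
     (\<forall>t\<in>{0<..<T}. w t \<in> S22 \<and> w' t \<in> S22 \<and> w'' t \<in> S22) \<and>
     S22_deriv_on {0<..<T} w w' \<and> S22_deriv_on {0<..<T} w' w'' \<and>
     S22_continuous_on {0<..<T} w'')"

section \<open>Space-time domain and test functions\<close>

definition Omega :: "real \<Rightarrow> ('n::finite heis \<times> real) set" where
  "Omega T = UNIV \<times> {0<..<T}"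

definition Lp_Omega :: "real \<Rightarrow> real \<Rightarrow> (real \<Rightarrow> 'n::finite heis \<Rightarrow> real) \<Rightarrow> bool" where
  "Lp_Omega T p w \<longleftrightarrow>
     set_borel_measurable lebesgue (Omega T) (\<lambda>(x, t). w t x) \<and>
     set_integrable lebesgue (Omega T) (\<lambda>(x, t). \<bar>w t x\<bar> powr p)"

text \<open>Time derivative on \<open>[0, T]\<close>, one-sided at the two end points.\<close>

definition dt :: "real \<Rightarrow> (real \<Rightarrow> 'n::finite heis \<Rightarrow> real) \<Rightarrow> real \<Rightarrow> 'n heis \<Rightarrow> real" where
  "dt T \<phi> t x = vector_derivative (\<lambda>s. \<phi> s x) (at t within {0..T})"

definition dt_exists :: "real \<Rightarrow> (real \<Rightarrow> 'n::finite heis \<Rightarrow> real) \<Rightarrow> bool" where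
  "dt_exists T \<phi> \<longleftrightarrow>
     (\<forall>x. \<forall>t\<in>{0..T}. (\<lambda>s. \<phi> s x) differentiable (at t within {0..T}))"

text \<open>All spatial partial derivatives of order at most 2 exist and are continuous in \<open>(x, t)\<close>.\<close>

definition C2_in_x :: "real \<Rightarrow> (real \<Rightarrow> 'n::finite heis \<Rightarrow> real) \<Rightarrow> bool" where
  "C2_in_x T \<phi> \<longleftrightarrow>
     (\<forall>bs\<in>lists Basis. length bs \<le> 2 \<longrightarrow>
        continuous_on (UNIV \<times> {0..T}) (\<lambda>(x, t). foldr pdir bs (\<phi> t) x)) \<and>
     (\<forall>bs\<in>lists Basis. length bs < 2 \<longrightarrow>
        (\<forall>b\<in>Basis. \<forall>x. \<forall>t\<in>{0..T}.
           (\<lambda>s. foldr pdir bs (\<phi> t) (x + s *\<^sub>R b)) differentiable (at 0)))"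

text \<open>
  The class \<open>C(2,2)\<close> has to contain the mixed derivatives of order up to 2 in \<open>x\<close> and up to
  2 in \<open>t\<close>, because the Kohn-Laplacian of the second time derivative occurs in the weak
  formulation; and it has to reach \<open>t = 0\<close>, where the initial data are tested. Test functions
  have compact support in space; no condition is imposed at \<open>t = 0\<close> or \<open>t = T\<close>.
\<close>

definition test_fun :: "real \<Rightarrow> (real \<Rightarrow> 'n::finite heis \<Rightarrow> real) \<Rightarrow> bool" where
  "test_fun T \<phi> \<longleftrightarrow>
     (\<forall>t\<in>{0..T}. \<forall>x. 0 \<le> \<phi> t x) \<and>
     dt_exists T \<phi> \<and> dt_exists T (dt T \<phi>) \<and>
     C2_in_x T \<phi> \<and> C2_in_x T (dt T \<phi>) \<and> C2_in_x T (dt T (dt T \<phi>)) \<and>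
     (\<exists>K. compact K \<and> (\<forall>t\<in>{0..T}. \<forall>x. x \<notin> K \<longrightarrow> \<phi> t x = 0))"

section \<open>Weak solutions\<close>

text \<open>
  The weak form of \<open>w\<^sub>t\<^sub>t - m(t) (\<Delta>w + \<Delta>w\<^sub>t\<^sub>t) = |z|\<^sup>r\<close> with data \<open>w = w0\<close>, \<open>w\<^sub>t = w1\<close> at \<open>t = 0\<close>.
  The only integral whose existence does not already follow from the membership conditions
  in \<open>weak_solution\<close> is the one with the coefficient \<open>m\<close> (no measurability of it is assumed),
  hence the explicit integrability requirement.
\<close>

definition weak_identity ::
    "real \<Rightarrow> (real \<Rightarrow> real) \<Rightarrow> real \<Rightarrow> ('n::finite heis \<Rightarrow> real) \<Rightarrow> ('n heis \<Rightarrow> real) \<Rightarrow>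
     (real \<Rightarrow> 'n heis \<Rightarrow> real) \<Rightarrow> (real \<Rightarrow> 'n heis \<Rightarrow> real) \<Rightarrow> bool" where
  "weak_identity T m r w0 w1 w z \<longleftrightarrow> (\<forall>\<phi>. test_fun T \<phi> \<longrightarrow>
     set_integrable lebesgue (Omega T)
       (\<lambda>(x, t). m t * w t x * (kohn_laplacian (\<phi> t) x + kohn_laplacian (dt T (dt T \<phi>) t) x)) \<and>
     (LINT (x, t):Omega T|lebesgue. \<bar>z t x\<bar> powr r * \<phi> t x)
       + (LINT x|lebesgue. w1 x * (\<phi> 0 x - kohn_laplacian (\<phi> 0) x))
       - (LINT x|lebesgue. w0 x * (dt T \<phi> 0 x - kohn_laplacian (dt T \<phi> 0) x))
     = (LINT (x, t):Omega T|lebesgue. w t x * dt T (dt T \<phi>) t x)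
       - (LINT (x, t):Omega T|lebesgue.
            m t * w t x * (kohn_laplacian (\<phi> t) x + kohn_laplacian (dt T (dt T \<phi>) t) x)))"

definition kirchhoff_coeff ::
    "(real \<Rightarrow> real \<Rightarrow> real \<Rightarrow> real \<Rightarrow> real \<Rightarrow> real) \<Rightarrow>
     (real \<Rightarrow> 'n::finite heis \<Rightarrow> real) \<Rightarrow> (real \<Rightarrow> 'n heis \<Rightarrow> real) \<Rightarrow> real \<Rightarrow> real" where
  "kirchhoff_coeff M u v t =
     M t (grad_energy (u t)) (grad_energy (v t)) (kohn_energy (u t)) (kohn_energy (v t))"

definition weak_solution ::
    "real \<Rightarrow> real \<Rightarrow> real \<Rightarrow>
     (real \<Rightarrow> real \<Rightarrow> real \<Rightarrow> real \<Rightarrow> real \<Rightarrow> real) \<Rightarrow> (real \<Rightarrow> real \<Rightarrow> real \<Rightarrow> real \<Rightarrow> real \<Rightarrow> real) \<Rightarrow>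
     ('n::finite heis \<Rightarrow> real) \<Rightarrow> ('n heis \<Rightarrow> real) \<Rightarrow> ('n heis \<Rightarrow> real) \<Rightarrow> ('n heis \<Rightarrow> real) \<Rightarrow>
     (real \<Rightarrow> 'n heis \<Rightarrow> real) \<Rightarrow> (real \<Rightarrow> 'n heis \<Rightarrow> real) \<Rightarrow> bool" where
  "weak_solution T p q M1 M2 u0 v0 u1 v1 u v \<longleftrightarrow>
     L1_loc u0 \<and> L1_loc v0 \<and> L1_loc u1 \<and> L1_loc v1 \<and>
     C2_S22 T u \<and> Lp_Omega T p u \<and> C2_S22 T v \<and> Lp_Omega T q v \<and>
     weak_identity T (kirchhoff_coeff M1 u v) q u0 u1 u v \<and>
     weak_identity T (kirchhoff_coeff M2 u v) p v0 v1 v u"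

definition nontrivial ::
    "real \<Rightarrow> (real \<Rightarrow> 'n::finite heis \<Rightarrow> real) \<Rightarrow> (real \<Rightarrow> 'n heis \<Rightarrow> real) \<Rightarrow> bool" where
  "nontrivial T u v \<longleftrightarrow>
     \<not> (AE (x, t) in lebesgue. (x, t) \<in> Omega T \<longrightarrow> u t x = 0 \<and> v t x = 0)"

end

theory Submission
  imports Defs
begin

text \<open>
  Test functions need not vanish near \<open>t = T\<close>, so a spatial cutoff \<open>\<chi>\<^sub>R\<close> that does not depend on time
  is admissible, and the first identity becomes
  \<open>\<integral>|v|\<^sup>q \<chi>\<^sub>R + \<integral>u\<^sub>1 (\<chi>\<^sub>R - \<Delta>\<chi>\<^sub>R) = - \<integral>M\<^sub>1 u \<Delta>\<chi>\<^sub>R\<close>.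
  For the cutoff at scale \<open>R\<close> adapted to the dilations, \<open>\<Delta>\<chi>\<^sub>R = O(1 / R\<^sup>2)\<close> on a set of measure
  \<open>O(R\<^bsup>Q\<^esup>)\<close>; with \<open>|u| \<le> l + l\<^bsup>1-p\<^esup> |u|\<^sup>p\<close>, \<open>l = R\<^bsup>-k\<^esup>\<close>, the right-hand side is
  \<open>O(R\<^bsup>Q-2-k\<^esup> + R\<^bsup>k(p-1)-2\<^esup>)\<close>, which tends to \<open>0\<close> for a suitable \<open>k\<close> as soon as \<open>(p - 1) (Q - 2) < 2\<close>.
  Then \<open>\<integral>|v|\<^sup>q + \<integral>u\<^sub>1 = 0\<close>, so \<open>v = 0\<close>, and the second identity yields \<open>\<integral>|u|\<^sup>p + \<integral>v\<^sub>1 = 0\<close>, so \<open>u = 0\<close>.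
  The hypothesis on \<open>p q\<close> implies \<open>(p - 1) (Q - 2) < 2\<close> if \<open>p \<le> q\<close>, and symmetrically
  \<open>(q - 1) (Q - 2) < 2\<close> if \<open>q \<le> p\<close>.
\<close>

section \<open>Cutoff functions\<close>

lemma has_real_derivative_max_0_power:
  fixes y :: real
  shows "((\<lambda>y. max 0 y ^ (k + 2)) has_real_derivative real (k + 2) * max 0 y ^ (k + 1)) (at y)"
proof (cases y "0 :: real" rule: linorder_cases)
  case less
  have "((\<lambda>y. 0) has_real_derivative 0) (at y)" by simp
  moreover have "\<forall>\<^sub>F z in nhds y. max 0 z ^ (k + 2) = 0"
    using eventually_nhds_in_open[of "{..<0}" y] less by (auto elim!: eventually_mono)
  ultimately show ?thesis
    using less by (subst DERIV_cong_ev[OF refl _ refl, where g = "\<lambda>_. 0"]) auto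
next
  case greater
  have "((\<lambda>y. y ^ (k + 2)) has_real_derivative real (k + 2) * y ^ (k + 1)) (at y)"
    using DERIV_pow[of "k + 2" y] by simp
  moreover have "\<forall>\<^sub>F z in nhds y. max 0 z ^ (k + 2) = z ^ (k + 2)"
    using eventually_nhds_in_open[of "{0<..}" y] greater by (auto elim!: eventually_mono)
  ultimately show ?thesis
    using greater by (subst DERIV_cong_ev[OF refl _ refl, where g = "\<lambda>y. y ^ (k + 2)"]) auto
next
  case equal
  have "((\<lambda>h. max 0 h ^ (k + 1)) \<longlongrightarrow> max 0 0 ^ (k + 1)) (at (0::real))"
    by (intro tendsto_intros)
  \<comment> \<open>This covers \<open>h = 0\<close> and negative \<open>h\<close> as well: both
    sides are then 0. The difference quotient at 0 is thus a continuous function vanishing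
    there.\<close>
  moreover have "max 0 h ^ (k + 2) / h = max 0 h ^ (k + 1)" for h :: real
    by (cases "h > 0") (auto simp: max_def)
  ultimately show ?thesis
    using equal by (simp add: DERIV_def)
qed

text \<open>A piecewise polynomial replaces a smooth bump: each derivative lowers the exponent by
  one, so exponent 3 already gives the two continuous derivatives that \<open>C2_in_x\<close>
  requires.\<close>

definition ramp :: "nat \<Rightarrow> real \<Rightarrow> real" where
  "ramp k y = max 0 (1 - y) ^ k"

lemma ramp_has_derivative:
  assumes "2 \<le> k" "(f has_derivative f') (at x)"
  shows "((\<lambda>x. ramp k (f x)) has_derivative (\<lambda>h. - real k * ramp (k - 1) (f x) * f' h)) (at x)"
proof -
  obtain j where j: "k = j + 2"
    using assms(1) le_Suc_ex by (metis add.commute)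
  have "((\<lambda>x. 1 - f x) has_derivative (\<lambda>h. - f' h)) (at x)"
    using assms(2) by (auto intro!: derivative_eq_intros)
  from DERIV_compose_FDERIV[OF has_real_derivative_max_0_power this, of j]
  show ?thesis by (simp add: ramp_def j algebra_simps)
qed

lemma ramp_nonneg: "0 \<le> ramp k y"
  by (simp add: ramp_def)

lemma ramp_le_1: "0 \<le> y \<Longrightarrow> ramp k y \<le> 1"
  by (simp add: ramp_def power_le_one)

lemma ramp_eq_0: "1 < y \<Longrightarrow> 0 < k \<Longrightarrow> ramp k y = 0"
  by (simp add: ramp_def)

lemma continuous_on_ramp [continuous_intros]:
  "continuous_on S f \<Longrightarrow> continuous_on S (\<lambda>x. ramp k (f x))"
  unfolding ramp_def by (intro continuous_intros)

text \<open>Links the partial derivatives \<open>pdir\<close> to Frechet derivatives, so that all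
  derivatives of the cutoff can be found with the rules for \<open>has_derivative\<close>.\<close>

lemma
  assumes "(f has_derivative D) (at x)"
  shows pdir_eq: "pdir b f x = D b"
    and line_differentiable: "(\<lambda>s. f (x + s *\<^sub>R b)) differentiable (at 0)"
proof -
  have "((\<lambda>s. x + s *\<^sub>R b) has_derivative (\<lambda>s. s *\<^sub>R b)) (at 0)"
    by (auto intro!: derivative_eq_intros)
  from has_derivative_compose[OF this, of f D]
  have *: "((\<lambda>s. f (x + s *\<^sub>R b)) has_derivative (\<lambda>s. D (s *\<^sub>R b))) (at 0)"
    using assms by simp
  then show "(\<lambda>s. f (x + s *\<^sub>R b)) differentiable (at 0)"
    by (auto simp: differentiable_def)
  have "D (s *\<^sub>R b) = D b * s" for s
    using linear_scale[OF has_derivative_linear[OF assms]] by simp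
  with * show "pdir b f x = D b"
    unfolding pdir_def by (intro DERIV_imp_deriv) (simp add: has_field_derivative_def)
qed

section \<open>The homogeneous gauge, the cutoff and their differentials\<close>

definition hor :: "'n::finite heis \<Rightarrow> 'n heis \<Rightarrow> real" where
  "hor x y = fst x \<bullet> fst y + fst (snd x) \<bullet> fst (snd y)"

definition ver :: "'n::finite heis \<Rightarrow> real" where
  "ver x = snd (snd x)"

text \<open>The fourth power of a homogeneous norm of the Heisenberg group.\<close>

definition gauge4 :: "'n::finite heis \<Rightarrow> real" where
  "gauge4 x = (hor x x)\<^sup>2 + (ver x)\<^sup>2"

definition D_gauge4 :: "'n::finite heis \<Rightarrow> 'n heis \<Rightarrow> real" where
  "D_gauge4 x h = 4 * hor x x * hor x h + 2 * ver x * ver h"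

definition D2_gauge4 :: "'n::finite heis \<Rightarrow> 'n heis \<Rightarrow> 'n heis \<Rightarrow> real" where
  "D2_gauge4 x h k = 8 * hor x k * hor x h + 4 * hor x x * hor k h + 2 * ver k * ver h"

text \<open>Since \<open>gauge4\<close> is homogeneous of degree 4, this is the cutoff at scale 1
  composed with the dilation by 1/R. It has no plateau where it equals 1; pointwise convergence to 1
  as R grows is what the limit uses.\<close>

definition cutoff :: "real \<Rightarrow> 'n::finite heis \<Rightarrow> real" where
  "cutoff R x = ramp 3 (gauge4 x / R ^ 4)"

definition D_cutoff :: "real \<Rightarrow> 'n::finite heis \<Rightarrow> 'n heis \<Rightarrow> real" where
  "D_cutoff R x h = - 3 * ramp 2 (gauge4 x / R ^ 4) * (D_gauge4 x h / R ^ 4)"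

definition D2_cutoff :: "real \<Rightarrow> 'n::finite heis \<Rightarrow> 'n heis \<Rightarrow> 'n heis \<Rightarrow> real" where
  "D2_cutoff R x h k =
     6 * ramp 1 (gauge4 x / R ^ 4) * (D_gauge4 x k / R ^ 4) * (D_gauge4 x h / R ^ 4)
     - 3 * ramp 2 (gauge4 x / R ^ 4) * (D2_gauge4 x h k / R ^ 4)"

lemma gauge4_has_derivative: "(gauge4 has_derivative D_gauge4 x) (at x)"
  unfolding gauge4_def[abs_def] D_gauge4_def[abs_def] hor_def ver_def
  by (auto intro!: derivative_eq_intros simp: inner_commute algebra_simps)

lemma D_gauge4_has_derivative: "((\<lambda>x. D_gauge4 x h) has_derivative D2_gauge4 x h) (at x)"
  unfolding D_gauge4_def[abs_def] D2_gauge4_def[abs_def] hor_def ver_def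
  by (auto intro!: derivative_eq_intros simp: inner_commute algebra_simps)

lemma cutoff_has_derivative: "(cutoff R has_derivative D_cutoff R x) (at x)"
proof -
  have "((\<lambda>x. gauge4 x / R ^ 4) has_derivative (\<lambda>h. D_gauge4 x h / R ^ 4)) (at x)"
    by (rule bounded_linear.has_derivative[OF bounded_linear_divide gauge4_has_derivative])
  from ramp_has_derivative[of 3, OF _ this] show ?thesis
    by (simp add: cutoff_def[abs_def] D_cutoff_def[abs_def])
qed

lemma D_cutoff_has_derivative: "((\<lambda>x. D_cutoff R x h) has_derivative D2_cutoff R x h) (at x)"
proof -
  have "((\<lambda>x. gauge4 x / R ^ 4) has_derivative (\<lambda>h. D_gauge4 x h / R ^ 4)) (at x)"
    by (rule bounded_linear.has_derivative[OF bounded_linear_divide gauge4_has_derivative])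
  note ramp_has_derivative[of 2, OF _ this]
  then have 1: "((\<lambda>x. ramp 2 (gauge4 x / R ^ 4)) has_derivative
      (\<lambda>k. - 2 * ramp 1 (gauge4 x / R ^ 4) * (D_gauge4 x k / R ^ 4))) (at x)"
    by simp
  have 2: "((\<lambda>x. D_gauge4 x h / R ^ 4) has_derivative (\<lambda>k. D2_gauge4 x h k / R ^ 4)) (at x)"
    by (rule bounded_linear.has_derivative[OF bounded_linear_divide D_gauge4_has_derivative])
  show ?thesis
    unfolding D_cutoff_def
    by (rule has_derivative_eq_rhs[OF has_derivative_mult[OF has_derivative_mult_right[OF 1, of "- 3"] 2]])
       (simp add: D2_cutoff_def fun_eq_iff)
qed

lemma continuous_on_gauge4 [continuous_intros]: "continuous_on S gauge4"
  unfolding gauge4_def[abs_def] hor_def ver_def by (intro continuous_intros)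

lemma continuous_on_cutoff [continuous_intros]: "continuous_on S (cutoff R)"
  unfolding cutoff_def[abs_def] divide_inverse by (intro continuous_intros)

lemma continuous_on_D_cutoff [continuous_intros]: "continuous_on S (\<lambda>x. D_cutoff R x h)"
  unfolding D_cutoff_def D_gauge4_def hor_def ver_def divide_inverse by (intro continuous_intros)

lemma continuous_on_D2_cutoff [continuous_intros]: "continuous_on S (\<lambda>x. D2_cutoff R x h k)"
  unfolding D2_cutoff_def D_gauge4_def D2_gauge4_def hor_def ver_def divide_inverse
  by (intro continuous_intros)

lemma pdir_cutoff: "pdir b (cutoff R) = (\<lambda>x. D_cutoff R x b)"
  by (intro ext pdir_eq cutoff_has_derivative)

lemma pdir_pdir_cutoff: "pdir c (pdir b (cutoff R)) = (\<lambda>x. D2_cutoff R x b c)"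
  unfolding pdir_cutoff by (intro ext pdir_eq D_cutoff_has_derivative)

section \<open>The Kohn-Laplacian of the cutoff\<close>

lemma e_components:
  "fst (e_xi i :: 'n::finite heis) = axis i 1" "fst (snd (e_xi i :: 'n heis)) = 0" "snd (snd (e_xi i :: 'n heis)) = 0"
  "fst (e_eta i :: 'n heis) = 0" "fst (snd (e_eta i :: 'n heis)) = axis i 1" "snd (snd (e_eta i :: 'n heis)) = 0"
  "fst (e_tau :: 'n heis) = 0" "fst (snd (e_tau :: 'n heis)) = 0" "snd (snd (e_tau :: 'n heis)) = 1"
  by (simp_all add: e_xi_def e_eta_def e_tau_def)

lemma X_field_cutoff:
  "X_field i (cutoff R) = (\<lambda>x. D_cutoff R x (e_xi i) + 2 * (fst (snd x) $ i) * D_cutoff R x e_tau)"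
  by (auto simp: X_field_def pdir_cutoff fun_eq_iff)

lemma Y_field_cutoff:
  "Y_field i (cutoff R) = (\<lambda>x. D_cutoff R x (e_eta i) - 2 * (fst x $ i) * D_cutoff R x e_tau)"
  by (auto simp: Y_field_def pdir_cutoff fun_eq_iff)

lemma D2_cutoff_bilinear:
  "D2_cutoff R x (h + h') k = D2_cutoff R x h k + D2_cutoff R x h' k"
  "D2_cutoff R x h (k + k') = D2_cutoff R x h k + D2_cutoff R x h k'"
  "D2_cutoff R x (h - h') k = D2_cutoff R x h k - D2_cutoff R x h' k"
  "D2_cutoff R x h (k - k') = D2_cutoff R x h k - D2_cutoff R x h k'"
  "D2_cutoff R x (c *\<^sub>R h) k = c * D2_cutoff R x h k"
  "D2_cutoff R x h (c *\<^sub>R k) = c * D2_cutoff R x h k"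
  by (simp_all add: D2_cutoff_def D_gauge4_def D2_gauge4_def hor_def ver_def inner_add_left
      inner_add_right inner_diff_left inner_diff_right algebra_simps add_divide_distrib diff_divide_distrib)

text \<open>At x the field is the direction z = \<open>e_xi i\<close> + 2 eta_i
  \<open>e_tau\<close>. Applying it twice gives the second differential at (z, z) plus a term from
  differentiating the coefficient 2 eta_i along z; that term vanishes because z has no
  eta-component.\<close>

lemma X_field_X_field_cutoff:
  fixes x :: "'n::finite heis"
  shows "X_field i (X_field i (cutoff R)) x =
     D2_cutoff R x (e_xi i + (2 * fst (snd x) $ i) *\<^sub>R e_tau) (e_xi i + (2 * fst (snd x) $ i) *\<^sub>R e_tau)"
proof -
  have c: "((\<lambda>x :: 'n heis. 2 * (fst (snd x) $ i)) has_derivative (\<lambda>k. 2 * (fst (snd k) $ i))) (at x)" for x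
    by (intro bounded_linear_imp_has_derivative bounded_linear_const_mult
        bounded_linear_compose[OF bounded_linear_vec_nth] bounded_linear_intros)
  have "((\<lambda>x. D_cutoff R x (e_xi i) + 2 * (fst (snd x) $ i) * D_cutoff R x e_tau) has_derivative
     (\<lambda>k. D2_cutoff R x (e_xi i) k + (2 * (fst (snd x) $ i) * D2_cutoff R x e_tau k
         + 2 * (fst (snd k) $ i) * D_cutoff R x e_tau))) (at x)" for x
    by (intro has_derivative_add has_derivative_mult c D_cutoff_has_derivative)
  note pd = pdir_eq[OF this]
  show ?thesis
    unfolding X_field_cutoff
    by (cases x) (simp add: X_field_def pd e_components, simp add: D2_cutoff_bilinear algebra_simps)
qed

lemma Y_field_Y_field_cutoff:
  fixes x :: "'n::finite heis"
  shows "Y_field i (Y_field i (cutoff R)) x =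
     D2_cutoff R x (e_eta i - (2 * fst x $ i) *\<^sub>R e_tau) (e_eta i - (2 * fst x $ i) *\<^sub>R e_tau)"
proof -
  have c: "((\<lambda>x :: 'n heis. 2 * (fst x $ i)) has_derivative (\<lambda>k. 2 * (fst k $ i))) (at x)" for x
    by (intro bounded_linear_imp_has_derivative bounded_linear_const_mult
        bounded_linear_compose[OF bounded_linear_vec_nth] bounded_linear_intros)
  have "((\<lambda>x. D_cutoff R x (e_eta i) - 2 * (fst x $ i) * D_cutoff R x e_tau) has_derivative
     (\<lambda>k. D2_cutoff R x (e_eta i) k - (2 * (fst x $ i) * D2_cutoff R x e_tau k
         + 2 * (fst k $ i) * D_cutoff R x e_tau))) (at x)" for x
    by (intro has_derivative_diff has_derivative_mult c D_cutoff_has_derivative)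
  note pd = pdir_eq[OF this]
  show ?thesis
    unfolding Y_field_cutoff
    by (cases x) (simp add: Y_field_def pd e_components, simp add: D2_cutoff_bilinear algebra_simps)
qed

lemma hor_eq_sum: "hor x x = (\<Sum>i\<in>UNIV. (fst x $ i)\<^sup>2 + (fst (snd x) $ i)\<^sup>2)"
  by (simp add: hor_def inner_vec_def sum.distrib power2_eq_square)

lemma hor_nonneg: "0 \<le> hor x x"
  by (simp add: hor_def)

text \<open>The identities \<open>|\<nabla>N|\<^sup>2 = 16 r N\<close> and \<open>\<Delta>N = (8 n + 16) r\<close> for \<open>N = gauge4\<close> and
  \<open>r = hor x x\<close>, combined by the chain rule.\<close>

lemma kohn_laplacian_cutoff:
  fixes x :: "'n::finite heis"
  shows "kohn_laplacian (cutoff R) x =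
    6 * ramp 1 (gauge4 x / R ^ 4) * (16 * hor x x * gauge4 x) / R ^ 8
    - 3 * ramp 2 (gauge4 x / R ^ 4) * ((8 * real CARD('n) + 16) * hor x x) / R ^ 4"
proof -
  \<comment> \<open>Here a and -b are the second and first derivatives of s \<mapsto>
    \<open>ramp 3 (s / R ^ 4)\<close> at s = \<open>gauge4 x\<close>.\<close>
  define a b where "a = 6 * ramp 1 (gauge4 x / R ^ 4) / R ^ 8" and "b = 3 * ramp 2 (gauge4 x / R ^ 4) / R ^ 4"
  have R8: "R ^ 8 = R ^ 4 * R ^ 4"
    by (simp add: power_add[symmetric])
  have D2: "D2_cutoff R x h h = a * (D_gauge4 x h)\<^sup>2 - b * D2_gauge4 x h h" for h
    unfolding D2_cutoff_def a_def b_def R8 by (simp add: power2_eq_square)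
  define zX zY where "zX i = e_xi i + (2 * fst (snd x) $ i) *\<^sub>R e_tau"
    and "zY i = e_eta i - (2 * fst x $ i) *\<^sub>R e_tau" for i :: 'n
  have z: "hor x (zX i) = fst x $ i" "hor (zX i) (zX i) = 1" "ver (zX i) = 2 * fst (snd x) $ i"
    "hor x (zY i) = fst (snd x) $ i" "hor (zY i) (zY i) = 1" "ver (zY i) = - 2 * fst x $ i" for i
    by (simp_all add: hor_def ver_def zX_def zY_def e_components inner_axis)
  \<comment> \<open>With r = \<open>hor x x\<close>, the first differentials of the gauge are 4 r
    xi_i + 4 tau eta_i and 4 r eta_i - 4 tau xi_i. The mixed terms cancel in the sum of their
    squares, leaving 16 (r^2 + tau^2) (xi_i^2 + eta_i^2).\<close>
  have "X_field i (X_field i (cutoff R)) x + Y_field i (Y_field i (cutoff R)) x =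
     (a * (16 * gauge4 x) - 16 * b) * ((fst x $ i)\<^sup>2 + (fst (snd x) $ i)\<^sup>2) - 8 * b * hor x x" for i
    unfolding X_field_X_field_cutoff Y_field_Y_field_cutoff D2 D_gauge4_def D2_gauge4_def gauge4_def
      zX_def[symmetric] zY_def[symmetric] z
    by algebra
  then have "kohn_laplacian (cutoff R) x =
     (\<Sum>i\<in>UNIV. (a * (16 * gauge4 x) - 16 * b) * ((fst x $ i)\<^sup>2 + (fst (snd x) $ i)\<^sup>2) - 8 * b * hor x x)"
    by (simp add: kohn_laplacian_def)
  also have "\<dots> = (a * (16 * gauge4 x) - 16 * b) * hor x x - real CARD('n) * (8 * b * hor x x)"
    by (simp add: sum_subtractf hor_eq_sum[of x] flip: sum_distrib_left)
  finally show ?thesis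
    by (simp add: a_def b_def algebra_simps add_divide_distrib)
qed

lemma hor_le:
  assumes "gauge4 x \<le> R ^ 4" "R > 0"
  shows "hor x x \<le> R\<^sup>2"
proof -
  have "(hor x x)\<^sup>2 \<le> gauge4 x"
    by (simp add: gauge4_def)
  also have "\<dots> \<le> (R\<^sup>2)\<^sup>2"
    using assms by (simp flip: power_mult)
  finally show ?thesis
    by (rule power2_le_imp_le) simp
qed

lemma kohn_laplacian_cutoff_eq_0:
  assumes "R ^ 4 < gauge4 x" "R > 0"
  shows "kohn_laplacian (cutoff R) x = 0"
proof -
  have "1 < gauge4 x / R ^ 4"
    using assms by simp
  then show ?thesis
    by (simp add: kohn_laplacian_cutoff ramp_eq_0)
qed

text \<open>In the rescaled quantities y = \<open>gauge4 x\<close> / R^4 and r =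
  \<open>hor x x\<close> / R^2, both in [0,1] where the cutoff can be nonzero, the explicit formula
  is 1/R^2 times a bounded expression. The two terms contribute 6 * 16 = 96 and 3 (8n + 16) = 24n +
  48.\<close>

lemma abs_kohn_laplacian_cutoff_le:
  fixes x :: "'n::finite heis"
  assumes "R > 0"
  shows "\<bar>kohn_laplacian (cutoff R) x\<bar> \<le> (144 + 24 * real CARD('n)) / R\<^sup>2"
proof (cases "gauge4 x \<le> R ^ 4")
  case True
  define y where "y = gauge4 x / R ^ 4"
  have y: "0 \<le> y" "y \<le> 1"
    using True assms by (auto simp: y_def gauge4_def)
  define r where "r = hor x x / R\<^sup>2"
  have r: "0 \<le> r" "r \<le> 1"
    using hor_le[OF True assms] assms hor_nonneg[of x] by (auto simp: r_def)
  have "kohn_laplacian (cutoff R) x =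
     (96 * (ramp 1 y * (r * y)) - (24 * real CARD('n) + 48) * (ramp 2 y * r)) / R\<^sup>2"
    unfolding kohn_laplacian_cutoff y_def r_def using assms
    by (simp add: field_simps eval_nat_numeral)
  moreover have "\<bar>96 * (ramp 1 y * (r * y)) - (24 * real CARD('n) + 48) * (ramp 2 y * r)\<bar>
      \<le> 96 + (24 * real CARD('n) + 48)"
  proof -
    have "0 \<le> ramp 1 y * (r * y)" "ramp 1 y * (r * y) \<le> 1"
         "0 \<le> ramp 2 y * r" "ramp 2 y * r \<le> 1"
      using y r by (auto intro!: mult_le_one mult_nonneg_nonneg ramp_nonneg ramp_le_1)
    moreover from this have "0 \<le> (24 * real CARD('n) + 48) * (ramp 2 y * r)"
        "(24 * real CARD('n) + 48) * (ramp 2 y * r) \<le> (24 * real CARD('n) + 48)"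
      by (auto intro!: mult_left_le)
    ultimately show ?thesis by linarith
  qed
  ultimately show ?thesis
    by (simp add: abs_divide divide_right_mono)
next
  case False
  then show ?thesis
    using assms by (simp add: kohn_laplacian_cutoff_eq_0)
qed

lemma continuous_on_kohn_laplacian_cutoff: "continuous_on S (kohn_laplacian (cutoff R))"
proof -
  have "continuous_on S (\<lambda>x. hor x x)"
    unfolding hor_def by (intro continuous_intros)
  then show ?thesis
    unfolding kohn_laplacian_cutoff[abs_def] divide_inverse by (intro continuous_intros)
qed

section \<open>An anisotropic box containing the support\<close>

definition heis_box :: "real \<Rightarrow> 'n::finite heis set" where
  "heis_box R = cbox (- (\<chi> i. R), - (\<chi> i. R), - R\<^sup>2) (\<chi> i. R, \<chi> i. R, R\<^sup>2)"

lemma gauge4_le_imp_heis_box: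
  fixes x :: "'n::finite heis"
  assumes "gauge4 x \<le> R ^ 4" "R > 0"
  shows "x \<in> heis_box R"
proof -
  have "(fst x $ i)\<^sup>2 \<le> R\<^sup>2 \<and> (fst (snd x) $ i)\<^sup>2 \<le> R\<^sup>2" for i
  proof -
    have "(fst x $ i)\<^sup>2 + (fst (snd x) $ i)\<^sup>2 \<le> hor x x"
      unfolding hor_eq_sum by (rule member_le_sum) auto
    with hor_le[OF assms] show ?thesis
      by (smt (verit) zero_le_power2)
  qed
  moreover have "(ver x)\<^sup>2 \<le> gauge4 x"
    by (simp add: gauge4_def)
  then have "(ver x)\<^sup>2 \<le> (R\<^sup>2)\<^sup>2"
    using assms(1) by (simp flip: power_mult)
  ultimately have "\<bar>fst x $ i\<bar> \<le> R \<and> \<bar>fst (snd x) $ i\<bar> \<le> R" "\<bar>ver x\<bar> \<le> R\<^sup>2" for i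
    using assms(2) power2_le_iff_abs_le[of R] power2_le_iff_abs_le[of "R\<^sup>2" "ver x"] by auto
  then have "- R \<le> fst x $ i \<and> fst x $ i \<le> R \<and> - R \<le> fst (snd x) $ i \<and> fst (snd x) $ i \<le> R"
    "- R\<^sup>2 \<le> ver x \<and> ver x \<le> R\<^sup>2" for i
    by (auto simp: abs_le_iff minus_le_iff)
  then show ?thesis
    by (cases x) (auto simp: heis_box_def cbox_Pair_eq mem_box_cart ver_def)
qed

text \<open>The 2n sides of length 2R and the vertical side of length 2R^2 produce the homogeneous
  dimension Q = 2n + 2 as exponent, written with \<open>powr\<close> to combine with the real
  exponents of the later estimate.\<close>

lemma content_heis_box:
  assumes "R > 0"
  shows "measure lborel (heis_box R :: 'n::finite heis set) = 2 * (2 ^ CARD('n))\<^sup>2 * R powr real (2 * CARD('n) + 2)"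
proof -
  have "measure lborel (heis_box R :: 'n heis set) = (2 * R) ^ CARD('n) * ((2 * R) ^ CARD('n) * (2 * R\<^sup>2))"
    using assms by (simp add: heis_box_def content_Pair content_cbox_if_cart interval_eq_empty_cart)
  also have "\<dots> = 2 * (2 ^ CARD('n))\<^sup>2 * R ^ (2 * CARD('n) + 2)"
    by (simp add: power_mult_distrib power_add power_even_eq) (simp add: power2_eq_square)
  finally show ?thesis
    using assms by (simp only: powr_realpow)
qed

lemma cutoff_eq_0: "R ^ 4 < gauge4 x \<Longrightarrow> R > 0 \<Longrightarrow> cutoff R x = 0"
  by (simp add: cutoff_def ramp_eq_0)

lemma cutoff_bounds: "0 \<le> cutoff R x" "cutoff R x \<le> 1"
  by (auto simp: cutoff_def gauge4_def intro!: ramp_nonneg ramp_le_1)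

section \<open>Time-independent cutoffs as test functions\<close>

lemma foldr_pdir_zero: "foldr pdir bs (\<lambda>x. 0) = (\<lambda>x. 0)"
  by (induction bs) (auto simp: pdir_def)

lemma kohn_laplacian_zero: "kohn_laplacian (\<lambda>x. 0) = (\<lambda>x. 0)"
  by (auto simp: kohn_laplacian_def X_field_def Y_field_def pdir_def fun_eq_iff cong: if_cong)

lemma C2_in_x_zero:
  assumes "\<And>t. t \<in> {0..T} \<Longrightarrow> \<phi> t = (\<lambda>x. 0)"
  shows "C2_in_x T \<phi>"
proof -
  have "continuous_on (UNIV \<times> {0..T}) (\<lambda>(x, t). foldr pdir bs (\<phi> t) x)" for bs
    by (subst continuous_on_cong[OF refl, where g = "\<lambda>_. 0"]) (auto simp: assms foldr_pdir_zero)
  then show ?thesis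
    by (auto simp: C2_in_x_def assms foldr_pdir_zero)
qed

lemma has_vector_derivative_zero:
  assumes "\<And>s. s \<in> S \<Longrightarrow> f s = c" "t \<in> S"
  shows "(f has_vector_derivative 0) (at t within S)"
  by (rule has_vector_derivative_transform[OF assms(2) _ has_vector_derivative_const[of c]]) (simp add: assms)

text \<open>Constancy is assumed on \<open>{0..T}\<close> only, so that the lemma applies again to
  \<open>dt T \<phi>\<close>, which is known to vanish just there. \<open>T > 0\<close> makes the
  derivative within the interval unique.\<close>

lemma dt_eq_zero:
  assumes "\<And>s. s \<in> {0..T} \<Longrightarrow> \<phi> s = f" "t \<in> {0..T}" "T > 0"
  shows "dt T \<phi> t = (\<lambda>x. 0)"
proof
  fix x
  have "((\<lambda>s. \<phi> s x) has_vector_derivative 0) (at t within {0..T})"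
    using assms(1,2) by (intro has_vector_derivative_zero[where c = "f x"]) auto
  then show "dt T \<phi> t x = 0"
    unfolding dt_def using assms(2,3) by (intro vector_derivative_within_closed_interval) auto
qed

lemma dt_exists_const:
  assumes "\<And>s. s \<in> {0..T} \<Longrightarrow> \<phi> s = f"
  shows "dt_exists T \<phi>"
  unfolding dt_exists_def
  by (intro allI ballI differentiableI_vector[OF has_vector_derivative_zero[where c = "f _"]])
     (auto simp: assms)

lemma C2_in_x_cutoff: "C2_in_x T (\<lambda>t. cutoff R :: 'n::finite heis \<Rightarrow> real)"
proof -
  have c: "continuous_on (UNIV \<times> {0..T}) (\<lambda>(x, t). f x)" if "continuous_on UNIV f"
    for f :: "'n heis \<Rightarrow> real"
    unfolding case_prod_beta by (rule continuous_on_compose2[OF that]) (auto intro: continuous_intros)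
  have "continuous_on (UNIV \<times> {0..T}) (\<lambda>(x, t). foldr pdir bs (cutoff R) x)"
    if "length bs \<le> 2" for bs :: "'n heis list"
    using that
    \<comment> \<open>Lists of length 0, 1 and 2 give \<open>cutoff\<close>, \<open>D_cutoff\<close>
      and \<open>D2_cutoff\<close>, each continuous.\<close>
    by (cases bs rule: list.exhaust[case_names Nil Cons]; cases "tl bs")
       (auto intro!: c continuous_intros simp: pdir_cutoff pdir_pdir_cutoff[unfolded pdir_cutoff])
  moreover have "(\<lambda>s. foldr pdir bs (cutoff R) (x + s *\<^sub>R b)) differentiable (at 0)"
    if "length bs < 2" for bs and b x :: "'n heis"
    using that
    by (cases bs)
       (auto simp: pdir_cutoff intro: line_differentiable[OF cutoff_has_derivative]
         line_differentiable[OF D_cutoff_has_derivative])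
  ultimately show ?thesis
    by (auto simp: C2_in_x_def)
qed

lemma test_fun_cutoff:
  assumes "T > 0" "R > 0"
  shows "test_fun T (\<lambda>t. cutoff R :: 'n::finite heis \<Rightarrow> real)"
proof -
  let ?\<phi> = "\<lambda>t. cutoff R :: 'n heis \<Rightarrow> real"
  have 1: "dt T ?\<phi> t = (\<lambda>x. 0)" if "t \<in> {0..T}" for t
    by (rule dt_eq_zero[OF _ that assms(1)]) simp
  have 2: "dt T (dt T ?\<phi>) t = (\<lambda>x. 0)" if "t \<in> {0..T}" for t
    by (rule dt_eq_zero[OF 1 that assms(1)])
  have "compact (heis_box R :: 'n heis set)"
    by (simp add: heis_box_def)
  moreover have "cutoff R x = 0" if "x \<notin> heis_box R" for x :: "'n heis"
    using that gauge4_le_imp_heis_box cutoff_eq_0 assms(2) by (metis linorder_not_le)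
  ultimately show ?thesis
    unfolding test_fun_def
    using dt_exists_const[of T ?\<phi>] dt_exists_const[of T "dt T ?\<phi>" "\<lambda>x. 0"]
      C2_in_x_zero[of T "dt T ?\<phi>"] C2_in_x_zero[of T "dt T (dt T ?\<phi>)"] 1 2
      C2_in_x_cutoff cutoff_bounds(1) by blast
qed

section \<open>The weak identities tested with cutoff functions\<close>

lemma open_Omega: "open (Omega T)"
  by (simp add: Omega_def open_Times)

lemma Omega_lebesgue [measurable]: "Omega T \<in> sets lebesgue"
  by (simp add: open_Omega)

text \<open>The time derivatives of the cutoff vanish on \<open>{0..T}\<close>, which removes the
  \<open>w0\<close> term and the first integral on the right. The integrability statement is kept
  because it is needed to estimate the coefficient term.\<close>

lemma weak_identity_cutoff:
  fixes w z :: "real \<Rightarrow> 'n::finite heis \<Rightarrow> real"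
  assumes "weak_identity T m r w0 w1 w z" "T > 0" "R > 0"
  shows "set_integrable lebesgue (Omega T) (\<lambda>(x, t). m t * w t x * kohn_laplacian (cutoff R) x)"
    and "(LINT (x, t):Omega T|lebesgue. \<bar>z t x\<bar> powr r * cutoff R x)
        + (LINT x|lebesgue. w1 x * (cutoff R x - kohn_laplacian (cutoff R) x))
      = - (LINT (x, t):Omega T|lebesgue. m t * w t x * kohn_laplacian (cutoff R) x)"
proof -
  let ?\<phi> = "\<lambda>t. cutoff R :: 'n heis \<Rightarrow> real"
  have 1: "dt T ?\<phi> t = (\<lambda>x. 0)" if "t \<in> {0..T}" for t
    by (rule dt_eq_zero[OF _ that assms(2)]) simp
  have 2: "dt T (dt T ?\<phi>) t = (\<lambda>x. 0)" if "t \<in> {0..T}" for t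
    by (rule dt_eq_zero[OF 1 that assms(2)])
  have 10: "dt T ?\<phi> 0 = (\<lambda>x. 0)"
    using assms by (intro 1) auto
  have eq: "(\<lambda>(x, t). m t * w t x * (kohn_laplacian (?\<phi> t) x + kohn_laplacian (dt T (dt T ?\<phi>) t) x)) y
      = (\<lambda>(x, t). m t * w t x * kohn_laplacian (cutoff R) x) y" if "y \<in> Omega T" for y
    using that by (auto simp: Omega_def 2 kohn_laplacian_zero)
  have eq': "(LINT (x, t):Omega T|lebesgue. w t x * dt T (dt T ?\<phi>) t x)
      = (LINT y:(Omega T :: ('n heis \<times> real) set)|lebesgue. 0)"
    by (rule set_lebesgue_integral_cong[OF Omega_lebesgue]) (auto simp: Omega_def 2)
  have eq'': "(LINT (x, t):Omega T|lebesgue.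
      m t * w t x * (kohn_laplacian (?\<phi> t) x + kohn_laplacian (dt T (dt T ?\<phi>) t) x))
      = (LINT (x, t):Omega T|lebesgue. m t * w t x * kohn_laplacian (cutoff R) x)"
    using eq by (intro set_lebesgue_integral_cong Omega_lebesgue) blast
  have si: "set_integrable lebesgue (Omega T)
      (\<lambda>(x, t). m t * w t x * (kohn_laplacian (?\<phi> t) x + kohn_laplacian (dt T (dt T ?\<phi>) t) x))
      \<longleftrightarrow> set_integrable lebesgue (Omega T) (\<lambda>(x, t). m t * w t x * kohn_laplacian (cutoff R) x)"
    by (rule set_integrable_cong[OF refl refl eq])
  from assms(1)[unfolded weak_identity_def, rule_format, OF test_fun_cutoff[OF assms(2,3)]]
  show "set_integrable lebesgue (Omega T) (\<lambda>(x, t). m t * w t x * kohn_laplacian (cutoff R) x)"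
    and "(LINT (x, t):Omega T|lebesgue. \<bar>z t x\<bar> powr r * cutoff R x)
        + (LINT x|lebesgue. w1 x * (cutoff R x - kohn_laplacian (cutoff R) x))
      = - (LINT (x, t):Omega T|lebesgue. m t * w t x * kohn_laplacian (cutoff R) x)"
    unfolding si eq' eq'' 10 by (simp_all add: kohn_laplacian_zero)
qed

section \<open>Passage to the limit in the tested identity\<close>

lemma continuous_imp_measurable_lebesgue:
  fixes f :: "'a::euclidean_space \<Rightarrow> real"
  assumes "continuous_on UNIV f"
  shows "f \<in> borel_measurable lebesgue"
  using borel_measurable_continuous_onI[OF assms] by (simp add: measurable_completion)

lemma cutoff_measurable [measurable]:
  "cutoff R \<in> borel_measurable lebesgue" "(\<lambda>y. cutoff R (fst y)) \<in> borel_measurable lebesgue"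
  by (intro continuous_imp_measurable_lebesgue continuous_on_compose2[OF continuous_on_cutoff]
      continuous_intros; auto)+

lemma kohn_laplacian_cutoff_measurable [measurable]:
  "kohn_laplacian (cutoff R) \<in> borel_measurable lebesgue"
  by (intro continuous_imp_measurable_lebesgue continuous_on_kohn_laplacian_cutoff)

lemma tendsto_cutoff: "((\<lambda>R. cutoff R x) \<longlongrightarrow> 1) at_top"
proof -
  have "((\<lambda>R. gauge4 x / R ^ 4) \<longlongrightarrow> 0) at_top"
    by (intro real_tendsto_divide_at_top[OF tendsto_const] filterlim_pow_at_top filterlim_ident) simp
  then have "((\<lambda>R. max 0 (1 - gauge4 x / R ^ 4) ^ 3) \<longlongrightarrow> max 0 (1 - 0) ^ 3) at_top"
    by (intro tendsto_intros)
  then show ?thesis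
    by (simp add: cutoff_def ramp_def)
qed

lemma tendsto_kohn_laplacian_cutoff: "((\<lambda>R. kohn_laplacian (cutoff R) (x :: 'n::finite heis)) \<longlongrightarrow> 0) at_top"
proof (rule Lim_null_comparison)
  show "\<forall>\<^sub>F R in at_top. norm (kohn_laplacian (cutoff R) x) \<le> (144 + 24 * real CARD('n)) / R\<^sup>2"
    using eventually_gt_at_top[of 0] by eventually_elim (simp add: abs_kohn_laplacian_cutoff_le)
  show "((\<lambda>R. (144 + 24 * real CARD('n)) / R\<^sup>2) \<longlongrightarrow> 0) at_top"
    by (intro real_tendsto_divide_at_top[OF tendsto_const] filterlim_pow_at_top filterlim_ident) simp
qed

lemma filterlim_real_Suc: "filterlim (\<lambda>j. real (Suc j)) at_top sequentially"
  by (intro filterlim_compose[OF filterlim_real_sequentially] filterlim_Suc)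

text \<open>Dominated convergence handles both terms on the left, with majorants |z|^r and a
  multiple of |w1|. The decay of the coefficient term is isolated in the hypothesis
  \<open>lim\<close>, since it is obtained differently for the two equations.\<close>

lemma weak_identity_limit:
  fixes w z :: "real \<Rightarrow> 'n::finite heis \<Rightarrow> real"
  assumes wi: "weak_identity T m r w0 w1 w z" and "T > 0"
    and w1: "integrable lebesgue w1" and z: "Lp_Omega T r z"
    and lim: "(\<lambda>j. LINT (x, t):Omega T|lebesgue. m t * w t x * kohn_laplacian (cutoff (real (Suc j))) x)
      \<longlonglongrightarrow> 0"
  shows "(LINT (x, t):Omega T|lebesgue. \<bar>z t x\<bar> powr r) + (LINT x|lebesgue. w1 x) = 0"
proof -
  let ?R = "\<lambda>j. real (Suc j)"
  let ?K = "144 + 24 * real CARD('n)"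
  have zi: "integrable lebesgue (\<lambda>y. indicator (Omega T) y *\<^sub>R (case y of (x, t) \<Rightarrow> \<bar>z t x\<bar> powr r))"
    using z by (simp add: Lp_Omega_def set_integrable_def)
  have "(\<lambda>j. LINT (x, t):Omega T|lebesgue. \<bar>z t x\<bar> powr r * cutoff (?R j) x)
      \<longlonglongrightarrow> (LINT (x, t):Omega T|lebesgue. \<bar>z t x\<bar> powr r)"
    unfolding set_lebesgue_integral_def
  proof (rule integral_dominated_convergence[OF _ _ zi])
    \<comment> \<open>Measurability is known for the product with the indicator, so the cutoff is
      multiplied onto that whole product.\<close>
    have "(\<lambda>y. (indicator (Omega T) y *\<^sub>R (case y of (x, t) \<Rightarrow> \<bar>z t x\<bar> powr r)) * cutoff (?R j) (fst y))
        \<in> borel_measurable lebesgue" for j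
      using borel_measurable_integrable[OF zi] by measurable
    then show "(\<lambda>y. indicator (Omega T) y *\<^sub>R (case y of (x, t) \<Rightarrow> \<bar>z t x\<bar> powr r * cutoff (?R j) x))
        \<in> borel_measurable lebesgue" for j
      by (simp add: case_prod_beta mult.assoc)
    show "(\<lambda>y. indicator (Omega T) y *\<^sub>R (case y of (x, t) \<Rightarrow> \<bar>z t x\<bar> powr r)) \<in> borel_measurable lebesgue"
      using zi by (rule borel_measurable_integrable)
    show "AE y in lebesgue. (\<lambda>j. indicator (Omega T) y *\<^sub>R
          (case y of (x, t) \<Rightarrow> \<bar>z t x\<bar> powr r * cutoff (?R j) x))
        \<longlonglongrightarrow> indicator (Omega T) y *\<^sub>R (case y of (x, t) \<Rightarrow> \<bar>z t x\<bar> powr r)"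
    proof (rule AE_I2)
      fix y :: "'n heis \<times> real"
      have "(\<lambda>j. cutoff (?R j) (fst y)) \<longlonglongrightarrow> 1"
        using filterlim_compose[OF tendsto_cutoff filterlim_real_Suc] .
      then have "(\<lambda>j. indicator (Omega T) y *\<^sub>R (\<bar>z (snd y) (fst y)\<bar> powr r * cutoff (?R j) (fst y)))
        \<longlonglongrightarrow> indicator (Omega T) y *\<^sub>R (\<bar>z (snd y) (fst y)\<bar> powr r * 1)"
        by (intro tendsto_intros)
      then show "(\<lambda>j. indicator (Omega T) y *\<^sub>R
          (case y of (x, t) \<Rightarrow> \<bar>z t x\<bar> powr r * cutoff (?R j) x))
        \<longlonglongrightarrow> indicator (Omega T) y *\<^sub>R (case y of (x, t) \<Rightarrow> \<bar>z t x\<bar> powr r)"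
        by (simp add: case_prod_beta)
    qed
    show "AE y in lebesgue. norm (indicator (Omega T) y *\<^sub>R
          (case y of (x, t) \<Rightarrow> \<bar>z t x\<bar> powr r * cutoff (?R j) x))
        \<le> indicator (Omega T) y *\<^sub>R (case y of (x, t) \<Rightarrow> \<bar>z t x\<bar> powr r)" for j
      by (rule AE_I2) (auto simp: indicator_def abs_mult cutoff_bounds intro!: mult_left_le)
  qed
  moreover have "(\<lambda>j. LINT x|lebesgue. w1 x * (cutoff (?R j) x - kohn_laplacian (cutoff (?R j)) x))
      \<longlonglongrightarrow> (LINT x|lebesgue. w1 x)"
  proof (rule integral_dominated_convergence)
    show m: "w1 \<in> borel_measurable lebesgue"
      using w1 by (rule borel_measurable_integrable)
    show "(\<lambda>x. w1 x * (cutoff (?R j) x - kohn_laplacian (cutoff (?R j)) x)) \<in> borel_measurable lebesgue" for j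
      using m by measurable
    show "integrable lebesgue (\<lambda>x. (1 + ?K) * \<bar>w1 x\<bar>)"
      using w1 by (intro integrable_mult_right integrable_abs)
    show "AE x in lebesgue. (\<lambda>j. w1 x * (cutoff (?R j) x - kohn_laplacian (cutoff (?R j)) x)) \<longlonglongrightarrow> w1 x"
    proof (rule AE_I2)
      fix x :: "'n heis"
      have "(\<lambda>j. w1 x * (cutoff (?R j) x - kohn_laplacian (cutoff (?R j)) x)) \<longlonglongrightarrow> w1 x * (1 - 0)"
        by (intro tendsto_intros filterlim_compose[OF tendsto_cutoff filterlim_real_Suc]
            filterlim_compose[OF tendsto_kohn_laplacian_cutoff filterlim_real_Suc])
      then show "(\<lambda>j. w1 x * (cutoff (?R j) x - kohn_laplacian (cutoff (?R j)) x)) \<longlonglongrightarrow> w1 x"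
        by simp
    qed
    show "AE x in lebesgue. norm (w1 x * (cutoff (?R j) x - kohn_laplacian (cutoff (?R j)) x))
        \<le> (1 + ?K) * \<bar>w1 x\<bar>" for j
    proof (rule AE_I2)
      fix x :: "'n heis"
      have "\<bar>kohn_laplacian (cutoff (?R j)) x\<bar> \<le> ?K / (?R j)\<^sup>2"
        by (rule abs_kohn_laplacian_cutoff_le) simp
      \<comment> \<open>The radii start at \<open>Suc 0\<close>, so R is at least 1 and the bound is
        uniform in \<open>j\<close>.\<close>
      also have "\<dots> \<le> ?K / 1"
        by (intro divide_left_mono) auto
      finally have "\<bar>kohn_laplacian (cutoff (?R j)) x\<bar> \<le> ?K"
        by simp
      then have "\<bar>cutoff (?R j) x - kohn_laplacian (cutoff (?R j)) x\<bar> \<le> 1 + ?K"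
        using cutoff_bounds[of "?R j" x] by (intro order_trans[OF abs_triangle_ineq4] add_mono) auto
      then show "norm (w1 x * (cutoff (?R j) x - kohn_laplacian (cutoff (?R j)) x)) \<le> (1 + ?K) * \<bar>w1 x\<bar>"
        unfolding real_norm_def abs_mult by (subst mult.commute) (intro mult_right_mono, auto)
    qed
  qed
  ultimately have "(\<lambda>j. (LINT (x, t):Omega T|lebesgue. \<bar>z t x\<bar> powr r * cutoff (?R j) x)
      + (LINT x|lebesgue. w1 x * (cutoff (?R j) x - kohn_laplacian (cutoff (?R j)) x)))
      \<longlonglongrightarrow> (LINT (x, t):Omega T|lebesgue. \<bar>z t x\<bar> powr r) + (LINT x|lebesgue. w1 x)"
    by (rule tendsto_add)
  moreover have "(LINT (x, t):Omega T|lebesgue. \<bar>z t x\<bar> powr r * cutoff (?R j) x)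
      + (LINT x|lebesgue. w1 x * (cutoff (?R j) x - kohn_laplacian (cutoff (?R j)) x))
      = - (LINT (x, t):Omega T|lebesgue. m t * w t x * kohn_laplacian (cutoff (?R j)) x)" for j
    by (rule weak_identity_cutoff(2)[OF wi \<open>T > 0\<close>]) simp
  ultimately have "(\<lambda>j. - (LINT (x, t):Omega T|lebesgue. m t * w t x * kohn_laplacian (cutoff (?R j)) x))
      \<longlonglongrightarrow> (LINT (x, t):Omega T|lebesgue. \<bar>z t x\<bar> powr r) + (LINT x|lebesgue. w1 x)"
    by simp
  from LIMSEQ_unique[OF this tendsto_minus[OF lim]] show ?thesis
    by simp
qed

section \<open>Decay of the coefficient term\<close>

lemma abs_le_add_powr:
  fixes a l p :: real
  assumes "l > 0" "p \<ge> 1"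
  shows "\<bar>a\<bar> \<le> l + l powr (1 - p) * \<bar>a\<bar> powr p"
proof (cases "\<bar>a\<bar> \<le> l")
  case True
  then show ?thesis
    by (smt (verit) mult_nonneg_nonneg powr_ge_zero)
next
  case False
  \<comment> \<open>Above the threshold \<open>l\<close> the factor with the nonpositive exponent 1
    - p is at most its value at \<open>l\<close>.\<close>
  have "\<bar>a\<bar> = \<bar>a\<bar> powr (1 - p) * \<bar>a\<bar> powr p"
    using False assms by (simp flip: powr_add)
  also have "\<dots> \<le> l powr (1 - p) * \<bar>a\<bar> powr p"
    using False assms by (intro mult_right_mono powr_mono2') auto
  finally show ?thesis
    using assms by linarith
qed

text \<open>The pointwise splitting at a threshold \<open>l\<close> takes the place of Hoelder's
  inequality. Its constant part is integrated over a box of volume of order R^Q, the other part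
  against the fixed integral of |w|^p; \<open>l\<close> is then a power of R that makes both
  contributions decay.\<close>

lemma coefficient_term_tendsto_0:
  fixes w z :: "real \<Rightarrow> 'n::finite heis \<Rightarrow> real"
  assumes wi: "weak_identity T m r w0 w1 w z" and T: "T > 0" and p: "p > 1"
    and sub: "(p - 1) * (2 * real CARD('n)) < 2"
    and w: "Lp_Omega T p w" and m: "\<And>t. 0 < t \<Longrightarrow> t < T \<Longrightarrow> \<bar>m t\<bar> \<le> C"
  shows "(\<lambda>j. LINT (x, t):Omega T|lebesgue. m t * w t x * kohn_laplacian (cutoff (real (Suc j))) x)
      \<longlonglongrightarrow> 0"
proof -
  have "2 * real CARD('n) < 2 / (p - 1)"
    using sub p by (simp add: field_simps)
  \<comment> \<open>These two inequalities make the final exponents 2n - k and k (p - 1) - 2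
    negative; \<open>sub\<close> says that the interval for \<open>k\<close> is nonempty.\<close>
  then obtain k where k: "2 * real CARD('n) < k" "k < 2 / (p - 1)"
    using dense by blast
  define K where "K = 144 + 24 * real CARD('n)"
  define J where "J = (LINT (x, t):Omega T|lebesgue. \<bar>w t x\<bar> powr p)"
  define A where "A = T * (2 * (2 ^ CARD('n))\<^sup>2)"
  have C: "0 \<le> C"
    using m[of "T / 2"] T by fastforce
  have wint: "integrable lebesgue (\<lambda>y. indicator (Omega T) y *\<^sub>R (case y of (x, t) \<Rightarrow> \<bar>w t x\<bar> powr p))"
    using w by (simp add: Lp_Omega_def set_integrable_def)
  have bound: "norm (LINT (x, t):Omega T|lebesgue. m t * w t x * kohn_laplacian (cutoff R) x)
      \<le> C * K * (A * R powr (2 * real CARD('n) - k) + J * R powr (k * (p - 1) - 2))" if "R > 0" for R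
  proof -
    define l where "l = R powr (- k)"
    have l: "l > 0" using that by (simp add: l_def)
    define B :: "('n heis \<times> real) set" where "B = heis_box R \<times> {0..T}"
    have B: "B = cbox ((- (\<chi> i. R), - (\<chi> i. R), - R\<^sup>2), 0) ((\<chi> i. R, \<chi> i. R, R\<^sup>2), T)"
      unfolding B_def heis_box_def cbox_Pair_eq[symmetric] by (simp add: cbox_Pair_eq)
    have cB: "measure lborel B = measure lborel (heis_box R :: 'n heis set) * T"
      unfolding B content_Pair[of _ 0] using T by (simp add: heis_box_def)
    have Bi: "integrable lebesgue (indicat_real B)"
      unfolding B using lmeasurable_cbox lmeasurable_iff_integrable by blast
    have R2: "C * K / R\<^sup>2 = C * K * R powr (- 2)"
      using that by (simp add: powr_minus_divide)
    have "norm (LINT (x, t):Omega T|lebesgue. m t * w t x * kohn_laplacian (cutoff R) x)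
      \<le> (LINT y|lebesgue. C * K / R\<^sup>2 * (l * indicat_real B y + l powr (1 - p) *
          (indicator (Omega T) y *\<^sub>R (case y of (x, t) \<Rightarrow> \<bar>w t x\<bar> powr p))))"
      unfolding set_lebesgue_integral_def
    \<comment> \<open>No measurability of \<open>m\<close> is assumed, so integrability of the
      left-hand side has to come from the weak identity itself.\<close>
    proof (rule order_trans[OF integral_norm_bound], rule integral_mono)
      show "integrable lebesgue (\<lambda>y. norm (indicator (Omega T) y *\<^sub>R
          (case y of (x, t) \<Rightarrow> m t * w t x * kohn_laplacian (cutoff R) x)))"
        using weak_identity_cutoff(1)[OF wi T that] by (intro integrable_norm) (simp add: set_integrable_def)
      show "integrable lebesgue (\<lambda>y. C * K / R\<^sup>2 * (l * indicat_real B y + l powr (1 - p) *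
          (indicator (Omega T) y *\<^sub>R (case y of (x, t) \<Rightarrow> \<bar>w t x\<bar> powr p))))"
        by (intro integrable_mult_right Bochner_Integration.integrable_add Bi wint)
      fix y :: "'n heis \<times> real"
      obtain x t where y: "y = (x, t)" by (cases y)
      show "norm (indicator (Omega T) y *\<^sub>R (case y of (x, t) \<Rightarrow> m t * w t x * kohn_laplacian (cutoff R) x))
        \<le> C * K / R\<^sup>2 * (l * indicat_real B y + l powr (1 - p) *
          (indicator (Omega T) y *\<^sub>R (case y of (x, t) \<Rightarrow> \<bar>w t x\<bar> powr p)))"
      proof (cases "y \<in> Omega T \<and> kohn_laplacian (cutoff R) x \<noteq> 0")
        case True
        then have t: "0 < t" "t < T" by (auto simp: Omega_def y)
        have "gauge4 x \<le> R ^ 4"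
          using True kohn_laplacian_cutoff_eq_0[OF _ that] by (metis linorder_not_le)
        then have "y \<in> B"
          using gauge4_le_imp_heis_box[OF _ that, of x] t by (simp add: B_def y)
        have "\<bar>m t * w t x * kohn_laplacian (cutoff R) x\<bar> = \<bar>m t\<bar> * \<bar>kohn_laplacian (cutoff R) x\<bar> * \<bar>w t x\<bar>"
          by (simp add: abs_mult)
        also have "\<dots> \<le> C * (K / R\<^sup>2) * (l + l powr (1 - p) * \<bar>w t x\<bar> powr p)"
          using m[OF t] abs_kohn_laplacian_cutoff_le[OF that, of x] abs_le_add_powr[OF l, of p "w t x"] C p
          by (intro mult_mono) (auto simp: K_def)
        finally show ?thesis
          using True \<open>y \<in> B\<close> by (simp add: y)
      next
        case False
        then have "indicator (Omega T) y *\<^sub>R (case y of (x, t) \<Rightarrow> m t * w t x * kohn_laplacian (cutoff R) x) = (0 :: real)"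
          by (auto simp: y)
        moreover have "0 \<le> C * K / R\<^sup>2 * (l * indicat_real B y + l powr (1 - p) *
          (indicator (Omega T) y *\<^sub>R (case y of (x, t) \<Rightarrow> \<bar>w t x\<bar> powr p)))"
          using C l by (auto simp: K_def y intro!: mult_nonneg_nonneg add_nonneg_nonneg)
        ultimately show ?thesis by (simp only: norm_zero)
      qed
    qed
    also have "\<dots> = C * K / R\<^sup>2 * (l * measure lborel B + l powr (1 - p) * J)"
      using Bi wint by (simp add: J_def set_lebesgue_integral_def B)
    \<comment> \<open>The factor R^(-2) comes from the Laplacian, R^(-k) is \<open>l\<close>, and
      R^(2n+2) is the volume of the box; \<open>A\<close> collects the remaining constants together
      with the time length T.\<close>
    also have "\<dots> = C * K * (A * (R powr (- 2) * (R powr (- k) * R powr (2 * real CARD('n) + 2)))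
        + J * (R powr (- 2) * (R powr (- k)) powr (1 - p)))"
      unfolding R2 cB content_heis_box[OF that] l_def A_def by (simp add: algebra_simps)
    also have "\<dots> = C * K * (A * R powr (2 * real CARD('n) - k) + J * R powr (k * (p - 1) - 2))"
      by (simp add: powr_powr algebra_simps flip: powr_add)
    finally show ?thesis .
  qed
  have "k * (p - 1) - 2 < 0"
    using k(2) p by (simp add: field_simps)
  then have "((\<lambda>R. C * K * (A * R powr (2 * real CARD('n) - k) + J * R powr (k * (p - 1) - 2)))
      \<longlongrightarrow> C * K * (A * 0 + J * 0)) at_top"
    using k(1) by (intro tendsto_intros tendsto_neg_powr filterlim_ident) auto
  from filterlim_compose[OF this filterlim_real_Suc]
  have "(\<lambda>j. C * K * (A * real (Suc j) powr (2 * real CARD('n) - k) + J * real (Suc j) powr (k * (p - 1) - 2)))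
      \<longlonglongrightarrow> 0"
    by simp
  then show ?thesis
    by (rule Lim_null_comparison[rotated]) (intro always_eventually allI bound; simp)
qed

section \<open>Vanishing of both components\<close>

lemma AE_zero_if_powr_integral_nonpos:
  fixes z :: "real \<Rightarrow> 'n::finite heis \<Rightarrow> real"
  assumes z: "Lp_Omega T r z" and "(LINT (x, t):Omega T|lebesgue. \<bar>z t x\<bar> powr r) \<le> 0"
  shows "AE (x, t) in lebesgue. (x, t) \<in> Omega T \<longrightarrow> z t x = 0"
proof -
  let ?f = "\<lambda>y. indicator (Omega T) y *\<^sub>R (case y of (x, t) \<Rightarrow> \<bar>z t x\<bar> powr r)"
  have int: "integrable lebesgue ?f"
    using z by (simp add: Lp_Omega_def set_integrable_def)
  have nn: "0 \<le> ?f y" for y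
    by (auto simp: indicator_def split: prod.split)
  have "integral\<^sup>L lebesgue ?f = 0"
    using assms(2) integral_nonneg_AE[of ?f lebesgue] nn
    unfolding set_lebesgue_integral_def by (intro antisym) auto
  then have "AE y in lebesgue. ?f y = 0"
    using integral_nonneg_eq_0_iff_AE[OF int] nn by auto
  then show ?thesis
    by eventually_elim (auto split: prod.splits)
qed

text \<open>The first identity in the limit forces v = 0, and this in turn kills the coefficient
  term of the second identity, which then forces u = 0. The asymmetric form lets the theorem treat
  the other ordering of the exponents by exchanging the equations.\<close>

lemma trivial_if_subcritical:
  fixes u v :: "real \<Rightarrow> 'n::finite heis \<Rightarrow> real"
  assumes T: "T > 0" and p: "p > 1"
    and sub: "(p - 1) * (2 * real CARD('n)) < 2"
    and u: "Lp_Omega T p u" and v: "Lp_Omega T q v"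
    and wi1: "weak_identity T m1 q u0 u1 u v" and wi2: "weak_identity T m2 p v0 v1 v u"
    and m1: "\<And>t. 0 < t \<Longrightarrow> t < T \<Longrightarrow> \<bar>m1 t\<bar> \<le> C"
    and u1: "integrable lebesgue u1" "0 \<le> (LINT x|lebesgue. u1 x)"
    and v1: "integrable lebesgue v1" "0 \<le> (LINT x|lebesgue. v1 x)"
  shows "\<not> nontrivial T u v"
proof -
  have "(LINT (x, t):Omega T|lebesgue. \<bar>v t x\<bar> powr q) + (LINT x|lebesgue. u1 x) = 0"
    by (rule weak_identity_limit[OF wi1 T u1(1) v coefficient_term_tendsto_0[OF wi1 T p sub u m1]])
  then have v0: "AE (x, t) in lebesgue. (x, t) \<in> Omega T \<longrightarrow> v t x = 0"
    using u1(2) by (intro AE_zero_if_powr_integral_nonpos[OF v]) linarith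
  \<comment> \<open>The integrand vanishes almost everywhere, which settles the integral whatever
    the measurability of \<open>m2\<close>.\<close>
  have "(LINT (x, t):Omega T|lebesgue. m2 t * v t x * kohn_laplacian (cutoff R) x) = 0" for R
    unfolding set_lebesgue_integral_def
    by (rule integral_eq_zero_AE) (use v0 in eventually_elim, auto simp: indicator_def)
  then have "(\<lambda>j. LINT (x, t):Omega T|lebesgue. m2 t * v t x * kohn_laplacian (cutoff (real (Suc j))) x)
      \<longlonglongrightarrow> 0"
    by simp
  from weak_identity_limit[OF wi2 T v1(1) u this]
  have "AE (x, t) in lebesgue. (x, t) \<in> Omega T \<longrightarrow> u t x = 0"
    using v1(2) by (intro AE_zero_if_powr_integral_nonpos[OF u]) linarith
  with v0 have "AE (x, t) in lebesgue. (x, t) \<in> Omega T \<longrightarrow> u t x = 0 \<and> v t x = 0"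
    by eventually_elim auto
  then show ?thesis
    by (simp add: nontrivial_def)
qed

text \<open>For q \<le> p one has (q - 1)(p + 1) = pq - 1 - (p - q) \<le> pq - 1. Dividing by p + 1
  gives q - 1 \<le> 2/(Q - 1) < 2/(Q - 2), so the smaller exponent is strictly subcritical even at
  equality in the hypothesis.\<close>

lemma subcritical_exponent:
  fixes p q Q :: real
  assumes "Q > 2" "1 < p" "q \<le> p" "p * q \<le> 1 + 2 / (Q - 1) * (p + 1)"
  shows "(q - 1) * (Q - 2) < 2"
proof -
  have "(q - 1) * (p + 1) \<le> p * q - 1"
    using assms(3) by (simp add: algebra_simps)
  also have "\<dots> \<le> 2 / (Q - 1) * (p + 1)"
    using assms(4) by simp
  also have "\<dots> < 2 / (Q - 2) * (p + 1)"
    using assms(1,2) by (intro mult_strict_right_mono divide_strict_left_mono) auto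
  finally have "q - 1 < 2 / (Q - 2)"
    by (rule mult_right_less_imp_less) (use assms(2) in simp)
  then show ?thesis
    using assms(1) by (simp add: field_simps)
qed

lemma kirchhoff_coeff_bounded:
  assumes "\<And>t a b c d. \<lbrakk>t \<ge> 0; a \<ge> 0; b \<ge> 0; c \<ge> 0; d \<ge> 0\<rbrakk> \<Longrightarrow> 0 < M t a b c d \<and> M t a b c d \<le> C"
    and "t \<ge> 0"
  shows "\<bar>kirchhoff_coeff M u v t\<bar> \<le> C"
proof -
  \<comment> \<open>Integrals of squares are nonnegative, including the default value 0 in the
    non-integrable case.\<close>
  have "0 \<le> grad_energy f" "0 \<le> kohn_energy f" for f :: "'a::finite heis \<Rightarrow> real"
    by (simp_all add: grad_energy_def kohn_energy_def)
  with assms show ?thesis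
    unfolding kirchhoff_coeff_def by (smt (verit))
qed

theorem theorem4p9:
  fixes T p q Q C1 C2 :: real
    and M1 M2 :: "real \<Rightarrow> real \<Rightarrow> real \<Rightarrow> real \<Rightarrow> real \<Rightarrow> real"
    and u0 v0 u1 v1 :: "'n::finite heis \<Rightarrow> real"
  assumes Q: "Q = 2 * real CARD('n) + 2"
    and T: "T > 0" and p: "p > 1" and q: "q > 1"
    and M1: "\<And>t a b c d. \<lbrakk>t \<ge> 0; a \<ge> 0; b \<ge> 0; c \<ge> 0; d \<ge> 0\<rbrakk> \<Longrightarrow> 0 < M1 t a b c d \<and> M1 t a b c d \<le> C1"
    and M2: "\<And>t a b c d. \<lbrakk>t \<ge> 0; a \<ge> 0; b \<ge> 0; c \<ge> 0; d \<ge> 0\<rbrakk> \<Longrightarrow> 0 < M2 t a b c d \<and> M2 t a b c d \<le> C2"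
    and data0: "integrable lebesgue u0" "integrable lebesgue v0"
    and data1: "integrable lebesgue u1" "integrable lebesgue v1"
    and u1_nonneg: "(LINT x|lebesgue. u1 x) \<ge> 0"
    and v1_nonneg: "(LINT x|lebesgue. v1 x) \<ge> 0"
    and pq: "1 < p * q" "p * q \<le> 1 + 2 / (Q - 1) * max (p + 1) (q + 1)"
  shows "\<not> (\<exists>u v. weak_solution T p q M1 M2 u0 v0 u1 v1 u v \<and> nontrivial T u v)"
proof clarify
  fix u v :: "real \<Rightarrow> 'n heis \<Rightarrow> real"
  assume sol: "weak_solution T p q M1 M2 u0 v0 u1 v1 u v" and nt: "nontrivial T u v"
  have Q2: "Q > 2" and Q': "Q - 2 = 2 * real CARD('n)"
    using Q by simp_all
  have wi: "weak_identity T (kirchhoff_coeff M1 u v) q u0 u1 u v"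
      "weak_identity T (kirchhoff_coeff M2 u v) p v0 v1 v u"
    and Lp: "Lp_Omega T p u" "Lp_Omega T q v"
    using sol by (simp_all add: weak_solution_def)
  have m1: "\<bar>kirchhoff_coeff M1 u v t\<bar> \<le> C1" if "0 < t" for t
    using that by (intro kirchhoff_coeff_bounded M1) auto
  have m2: "\<bar>kirchhoff_coeff M2 u v t\<bar> \<le> C2" if "0 < t" for t
    using that by (intro kirchhoff_coeff_bounded M2) auto
  show False
  proof (cases "p \<le> q")
    case True
    \<comment> \<open>The exponent lemma is used with \<open>p\<close> and \<open>q\<close>
      exchanged, the smaller one now being \<open>p\<close>.\<close>
    then have "(p - 1) * (Q - 2) < 2"
      using pq(2) by (intro subcritical_exponent[OF Q2 q]) (auto simp: mult.commute max_def)
    from trivial_if_subcritical[OF T p this[unfolded Q'] Lp wi m1 data1(1) u1_nonneg data1(2) v1_nonneg]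
    show False using nt by simp
  next
    case False
    then have "(q - 1) * (Q - 2) < 2"
      using pq(2) by (intro subcritical_exponent[OF Q2 p]) (auto simp: max_def)
    \<comment> \<open>The system is symmetric under exchanging (u, p) with (v, q), so the second
      equation is treated first.\<close>
    from trivial_if_subcritical[OF T q this[unfolded Q'] Lp(2,1) wi(2,1) m2 data1(2) v1_nonneg data1(1) u1_nonneg]
    show False using nt by (simp add: nontrivial_def conj_commute)
  qed
qed

end
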